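(* Let $\alpha\in(0,1]$, let $\theta>0$, and set $\tau(\mu):=(1+\mu)\theta$ for $\mu>0$. Then $$\lim_{\mu\to\infty}\varphi_{ss}^{\mu,\tau(\mu)}(\alpha)=\varphi^*(\alpha)\qquad\text{and}\qquad \limsup_{\mu\to\infty}S_{ss}^{\mu,\tau(\mu)}(\alpha)\subset S^*(\alpha),$$ where $\limsup$ of sets is the Painlevé–Kuratowski outer limit (the set of all cluster points of sequences $x_k\in S_{ss}^{\mu_k,\tau(\mu_k)}(\alpha)$ with $\mu_k\to\infty$).
   Context: $(\Omega,\mathcal{F},\mathbb{P})$ is a probability space and $\Xi:\Omega\to\mathbb{R}^d$ is a random vector. $\mathcal{X}=\{x\in\mathbb{R}^n : g(x)\ge 0\}$ is nonempty and compact, with $g:\mathbb{R}^n\to\mathbb{R}^m$ twice differentiable. The objective $\varphi:\mathbb{R}^n\to\mathbb{R}$ is twice continuously differentiable. The scalar function $f(x,\xi)$, $x\in\mathbb{R}^n$, $\xi\in\mathbb{R}^d$, is real-valued and twice continuously differentiable. $Z(x):=f(x,\Xi)$, with cumulative distribution function $F_{Z(x)}(t)=\mathbb{P}(Z(x)\le t)$. Chance-constrained problem: minimize $\varphi(x)$ over $\mathcal{X}(\alpha):=\{x\in\mathcal{X} : \mathbb{P}(f(x,\Xi)\le 0)\ge 1-\alpha\}$, which is assumed compact for all $\alpha\in(0,1]$. Its optimal value is $\varphi^*(\alpha)$ and its set of optimal solutions is $S^*(\alpha)$. Write $[a]_+:=\max\{a,0\}$ and, for $\mu,\tau>0$, $\psi_{ss}^{\mu,\tau}(z):=\left[2\,\frac{1+\mu}{\mu+e^{-\tau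 z}}-1\right]_+$. Define $$\text{SigVaR}_{1-\alpha}^{\mu,\tau}(Z):=\inf\{t\in\mathbb{R} : \mathbb{E}[\psi_{ss}^{\mu,\tau}(Z-t)]\le\alpha\}.$$ SigVaR problem: minimize $\varphi(x)$ over $$\mathcal{X}_{ss}^{\mu,\tau}(\alpha):=\{x\in\mathcal{X} : \text{SigVaR}_{1-\alpha}^{\mu,\tau}(f(x,\Xi))\le 0\},$$ equivalently over $\{x\in\mathcal{X} : \mathbb{E}[\psi_{ss}^{\mu,\tau}(f(x,\Xi))]\le\alpha\}$. Its optimal value is $\varphi_{ss}^{\mu,\tau}(\alpha)$ and its set of optimal solutions is $S_{ss}^{\mu,\tau}(\alpha)$. An optimal value over an empty feasible set is $+\infty$, and the corresponding solution set is empty. Standing assumptions: (i) there exists $\kappa>0$ such that, for every $x\in\mathcal{X}$, $F_{Z(x)}(t)$ is Lipschitz continuous in $t\in[-\kappa,\kappa]$; (ii) $\mathcal{X}(\alpha)=\mathrm{cl}\,\mathcal{X}^I(\alpha)$, where $\mathcal{X}^I(\alpha):=\{x\in\mathcal{X} : \mathbb{P}(f(x,\Xi)>0)<\alpha\}$ and $\mathrm{cl}$ denotes closure. *)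

theory Defs
  imports "HOL-Probability.Probability"
begin

text \<open>In both definitions below, \<open>f'\<close> and \<open>f''\<close> are the first and second Frechet derivatives;
  continuity of \<open>f''\<close> is with respect to the operator norm.\<close>

definition twice_differentiable :: "('a::real_normed_vector \<Rightarrow> 'b::real_normed_vector) \<Rightarrow> bool"
  where "twice_differentiable f \<longleftrightarrow>
    (\<exists>(f' :: 'a \<Rightarrow> 'a \<Rightarrow>\<^sub>L 'b) (f'' :: 'a \<Rightarrow> 'a \<Rightarrow>\<^sub>L 'a \<Rightarrow>\<^sub>L 'b). \<forall>x.
       (f has_derivative blinfun_apply (f' x)) (at x) \<and>
       (f' has_derivative blinfun_apply (f'' x)) (at x))"

definition twice_cont_differentiable ::
    "('a::real_normed_vector \<Rightarrow> 'b::real_normed_vector) \<Rightarrow> bool"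
  where "twice_cont_differentiable f \<longleftrightarrow>
    (\<exists>(f' :: 'a \<Rightarrow> 'a \<Rightarrow>\<^sub>L 'b) (f'' :: 'a \<Rightarrow> 'a \<Rightarrow>\<^sub>L 'a \<Rightarrow>\<^sub>L 'b).
       (\<forall>x. (f has_derivative blinfun_apply (f' x)) (at x) \<and>
            (f' has_derivative blinfun_apply (f'' x)) (at x)) \<and>
       continuous_on UNIV f'')"

definition constraint_set :: "(real ^ 'n \<Rightarrow> real ^ 'm) \<Rightarrow> (real ^ 'n) set"
  where "constraint_set g = {x. \<forall>j. 0 \<le> g x $ j}"

definition chance_feasible ::
    "'w measure \<Rightarrow> ('w \<Rightarrow> 'd) \<Rightarrow> ('x \<Rightarrow> 'd \<Rightarrow> real) \<Rightarrow> 'x set \<Rightarrow> real \<Rightarrow> 'x set"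
  where "chance_feasible M \<Xi> f X \<alpha> = {x \<in> X. \<P>(\<omega> in M. f x (\<Xi> \<omega>) \<le> 0) \<ge> 1 - \<alpha>}"

definition chance_feasible_strict ::
    "'w measure \<Rightarrow> ('w \<Rightarrow> 'd) \<Rightarrow> ('x \<Rightarrow> 'd \<Rightarrow> real) \<Rightarrow> 'x set \<Rightarrow> real \<Rightarrow> 'x set"
  where "chance_feasible_strict M \<Xi> f X \<alpha> = {x \<in> X. \<P>(\<omega> in M. f x (\<Xi> \<omega>) > 0) < \<alpha>}"

definition psi_ss :: "real \<Rightarrow> real \<Rightarrow> real \<Rightarrow> real"
  where "psi_ss \<mu> \<tau> z = max (2 * ((1 + \<mu>) / (\<mu> + exp (- \<tau> * z))) - 1) 0"

text \<open>\<open>SigVaR M \<mu> \<tau> \<alpha> Z\<close> is the SigVaR of \<open>Z\<close> at confidence level \<open>1 - \<alpha>\<close>. For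
  \<open>\<mu>, \<tau> > 0\<close>, \<open>0 < \<alpha> \<le> 1\<close> and a random variable \<open>Z\<close> on a probability space the set below is
  nonempty and bounded below: the expectation tends to \<open>0\<close> as \<open>t\<close> tends to infinity and to
  \<open>1 + 2 / \<mu> > \<alpha>\<close> as \<open>t\<close> tends to minus infinity. Hence the real-valued \<open>Inf\<close> is the true
  infimum.\<close>

definition SigVaR :: "'w measure \<Rightarrow> real \<Rightarrow> real \<Rightarrow> real \<Rightarrow> ('w \<Rightarrow> real) \<Rightarrow> real"
  where "SigVaR M \<mu> \<tau> \<alpha> Z = Inf {t. (\<integral>\<omega>. psi_ss \<mu> \<tau> (Z \<omega> - t) \<partial>M) \<le> \<alpha>}"

definition sigvar_feasible ::
    "'w measure \<Rightarrow> ('w \<Rightarrow> 'd) \<Rightarrow> ('x \<Rightarrow> 'd \<Rightarrow> real) \<Rightarrow> 'x set \<Rightarrow> real \<Rightarrow> real \<Rightarrow> real \<Rightarrow> 'x set"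
  where "sigvar_feasible M \<Xi> f X \<mu> \<tau> \<alpha> = {x \<in> X. SigVaR M \<mu> \<tau> \<alpha> (\<lambda>\<omega>. f x (\<Xi> \<omega>)) \<le> 0}"

text \<open>The infimum is taken in \<^typ>\<open>ereal\<close>, so it is \<open>\<infinity>\<close> for an empty feasible set.\<close>

definition optimal_value :: "('x \<Rightarrow> real) \<Rightarrow> 'x set \<Rightarrow> ereal"
  where "optimal_value \<phi> F = (INF x\<in>F. ereal (\<phi> x))"

definition optimal_solutions :: "('x \<Rightarrow> real) \<Rightarrow> 'x set \<Rightarrow> 'x set"
  where "optimal_solutions \<phi> F = {x \<in> F. \<forall>y\<in>F. \<phi> x \<le> \<phi> y}"

text \<open>Painleve-Kuratowski outer limit, as \<open>\<mu>\<close> tends to infinity, of a family of sets indexed by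
  positive reals: all limits of subsequences of sequences \<open>x k \<in> S (\<mu> k)\<close> with \<open>\<mu> k \<longlongrightarrow> \<infinity>\<close>.\<close>

definition outer_limit_at_top :: "(real \<Rightarrow> 'a::topological_space set) \<Rightarrow> 'a set"
  where "outer_limit_at_top S =
    {z. \<exists>(\<mu> :: nat \<Rightarrow> real) x r.
          filterlim \<mu> at_top sequentially \<and> (\<forall>k. 0 < \<mu> k \<and> x k \<in> S (\<mu> k)) \<and>
          strict_mono (r :: nat \<Rightarrow> nat) \<and> (x \<circ> r) \<longlonglongrightarrow> z}"

end

theory Submission
  imports Defs "HOL-Real_Asymp.Real_Asymp"
begin

text \<open>
  The function \<open>psi_ss \<mu> \<tau>\<close> is nondecreasing and at least \<open>1\<close> on the nonnegative half-line, so it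
  dominates the indicator of \<open>{z. 0 \<le> z}\<close> and every SigVaR-feasible point is chance-feasible, for all
  \<open>\<mu>, \<tau> > 0\<close> (lemma \<open>sigvar_feasible_subset_chance_feasible\<close>). Along \<open>\<tau> = (1 + \<mu>) * \<theta>\<close> it also
  converges pointwise to that indicator: on \<open>z < 0\<close> the exponential beats the linear growth of \<open>\<mu>\<close>, and
  on \<open>0 \<le> z\<close> its values lie between \<open>1\<close> and the supremum \<open>1 + 2 / \<mu>\<close>. By dominated convergence
  \<open>E[psi_ss \<mu> \<tau> Z]\<close> tends to \<open>P(0 \<le> Z)\<close>, which equals \<open>P(0 < Z)\<close> because the distribution function is
  continuous at \<open>0\<close>. Hence each point that satisfies the chance constraint strictly is
  SigVaR-feasible for all large \<open>\<mu>\<close> (lemma \<open>eventually_sigvar_feasible\<close>), where the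
  threshold for \<open>\<mu>\<close> depends on the point.

  These two inclusions, a closed outer bound and an eventual pointwise inner bound by a set dense in
  it, determine the limit of the optimal values and of the optimal solutions of any continuous
  objective (lemmas \<open>optimal_value_tendsto_of_dense_inner\<close> and
  \<open>outer_limit_optimal_solutions_of_dense_inner\<close>). Pointwise inner approximation suffices because the
  arguments only compare with one fixed competitor from the dense inner set at a time.
\<close>

section \<open>The sigmoidal function\<close>

lemma psi_ss_nonneg: "0 \<le> psi_ss \<mu> \<tau> z"
  by (simp add: psi_ss_def)

lemma psi_ss_le:
  assumes "0 < \<mu>"
  shows "psi_ss \<mu> \<tau> z \<le> 1 + 2 / \<mu>"
proof -
  have "(1 + \<mu>) / (\<mu> + exp (- \<tau> * z)) \<le> (1 + \<mu>) / \<mu>"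
    using assms by (intro divide_left_mono mult_pos_pos add_pos_pos) auto
  also have "\<dots> = 1 + 1 / \<mu>"
    using assms by (simp add: field_simps)
  finally have "2 * ((1 + \<mu>) / (\<mu> + exp (- \<tau> * z))) - 1 \<le> 2 * (1 + 1 / \<mu>) - 1"
    by (intro diff_right_mono mult_left_mono) auto
  also have "\<dots> = 1 + 2 / \<mu>"
    by simp
  finally show ?thesis
    using assms by (simp add: psi_ss_def del: times_divide_eq_right)
qed

lemma psi_ss_mono:
  assumes "0 < \<mu>" "0 < \<tau>" "y \<le> z"
  shows "psi_ss \<mu> \<tau> y \<le> psi_ss \<mu> \<tau> z"
proof -
  have "(1 + \<mu>) / (\<mu> + exp (- \<tau> * y)) \<le> (1 + \<mu>) / (\<mu> + exp (- \<tau> * z))"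
    using assms by (intro divide_left_mono mult_pos_pos add_pos_pos add_left_mono) auto
  then have "2 * ((1 + \<mu>) / (\<mu> + exp (- \<tau> * y))) - 1 \<le> 2 * ((1 + \<mu>) / (\<mu> + exp (- \<tau> * z))) - 1"
    by linarith
  then show ?thesis
    unfolding psi_ss_def by (intro max.mono order_refl)
qed

lemma one_le_psi_ss:
  assumes "0 < \<mu>" "0 < \<tau>" "0 \<le> z"
  shows "1 \<le> psi_ss \<mu> \<tau> z"
proof -
  have "psi_ss \<mu> \<tau> 0 = 1"
    using assms by (simp add: psi_ss_def add.commute)
  then show ?thesis
    using psi_ss_mono[OF assms] by simp
qed

lemma psi_ss_measurable [measurable]: "psi_ss \<mu> \<tau> \<in> borel_measurable borel"
  unfolding psi_ss_def by measurable

lemma psi_ss_at_top: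
  assumes "0 < \<mu>" "0 < \<tau>"
  shows "(psi_ss \<mu> \<tau> \<longlongrightarrow> 1 + 2 / \<mu>) at_top"
proof -
  have "((\<lambda>z. max (2 * ((1 + \<mu>) / (\<mu> + exp (- \<tau> * z))) - 1) 0) \<longlongrightarrow>
          max (2 * ((1 + \<mu>) / \<mu>) - 1) 0) at_top"
    using assms by (intro tendsto_max tendsto_const) (real_asymp simp: field_simps)
  also have "max (2 * ((1 + \<mu>) / \<mu>) - 1) 0 = 1 + 2 / \<mu>"
    using assms by (simp add: field_simps)
  finally show ?thesis
    unfolding psi_ss_def[abs_def] .
qed

lemma psi_ss_at_bot:
  assumes "0 < \<mu>" "0 < \<tau>"
  shows "(psi_ss \<mu> \<tau> \<longlongrightarrow> 0) at_bot"
proof -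
  have "((\<lambda>z. max (2 * ((1 + \<mu>) / (\<mu> + exp (- \<tau> * z))) - 1) 0) \<longlongrightarrow> max (- 1) 0) at_bot"
    using assms by (intro tendsto_max tendsto_const) real_asymp
  then show ?thesis
    unfolding psi_ss_def[abs_def] by simp
qed

text \<open>The coupling of the two parameters: \<open>exp (- \<tau> * z)\<close> has to outgrow \<open>\<mu>\<close> for each negative \<open>z\<close>,
  however close to \<open>0\<close>.\<close>

lemma psi_ss_tendsto_indicator:
  assumes "0 < \<theta>"
  shows "((\<lambda>\<mu>. psi_ss \<mu> ((1 + \<mu>) * \<theta>) z) \<longlongrightarrow> indicator {0..} z) at_top"
proof (cases "0 \<le> z")
  case True
  have "((\<lambda>\<mu>. psi_ss \<mu> ((1 + \<mu>) * \<theta>) z) \<longlongrightarrow> 1) at_top"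
  proof (rule tendsto_sandwich)
    show "\<forall>\<^sub>F \<mu> in at_top. 1 \<le> psi_ss \<mu> ((1 + \<mu>) * \<theta>) z"
      using eventually_gt_at_top[of 0]
      by eventually_elim (use assms True in \<open>auto intro!: one_le_psi_ss\<close>)
    show "\<forall>\<^sub>F \<mu> in at_top. psi_ss \<mu> ((1 + \<mu>) * \<theta>) z \<le> 1 + 2 / \<mu>"
      using eventually_gt_at_top[of 0] by eventually_elim (auto intro!: psi_ss_le)
    show "((\<lambda>\<mu>::real. 1 + 2 / \<mu>) \<longlongrightarrow> 1) at_top"
      by real_asymp
  qed simp
  then show ?thesis
    using True by simp
next
  case False
  define c where "c = \<theta> * - z"
  have "0 < c"
    using False assms unfolding c_def by (intro mult_pos_pos) auto
  then have "((\<lambda>\<mu>. max (2 * ((1 + \<mu>) / (\<mu> + exp ((1 + \<mu>) * c))) - 1) 0) \<longlongrightarrow> max (- 1) 0) at_top"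
    by (intro tendsto_max tendsto_const) real_asymp
  moreover have "psi_ss \<mu> ((1 + \<mu>) * \<theta>) z = max (2 * ((1 + \<mu>) / (\<mu> + exp ((1 + \<mu>) * c))) - 1) 0" for \<mu>
    by (simp add: psi_ss_def c_def mult.assoc)
  ultimately show ?thesis
    using False by simp
qed

section \<open>SigVaR and the chance constraint\<close>

context prob_space
begin

lemma integrable_psi_ss:
  assumes [measurable]: "random_variable borel Z" and "0 < \<mu>"
  shows "integrable M (\<lambda>\<omega>. psi_ss \<mu> \<tau> (Z \<omega>))"
  by (rule integrable_const_bound[where B = "1 + 2 / \<mu>"])
     (use assms in \<open>auto simp: psi_ss_nonneg psi_ss_le\<close>)

lemma prob_nonneg_le_expectation_psi_ss:
  assumes [measurable]: "random_variable borel Z" and "0 < \<mu>" "0 < \<tau>"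
  shows "\<P>(\<omega> in M. 0 \<le> Z \<omega>) \<le> expectation (\<lambda>\<omega>. psi_ss \<mu> \<tau> (Z \<omega>))"
proof -
  have "\<P>(\<omega> in M. 0 \<le> Z \<omega>) = expectation (indicator {\<omega> \<in> space M. 0 \<le> Z \<omega>})"
    by simp
  also have "\<dots> \<le> expectation (\<lambda>\<omega>. psi_ss \<mu> \<tau> (Z \<omega>))"
  proof (rule integral_mono)
    show "indicator {\<omega> \<in> space M. 0 \<le> Z \<omega>} \<omega> \<le> psi_ss \<mu> \<tau> (Z \<omega>)" for \<omega>
      using one_le_psi_ss[of \<mu> \<tau> "Z \<omega>"] assms by (auto simp: indicator_def psi_ss_nonneg)
  qed (use assms in \<open>auto intro!: integrable_psi_ss simp: less_top[symmetric]\<close>)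
  finally show ?thesis .
qed

lemma expectation_psi_ss_shift_tendsto:
  assumes [measurable]: "random_variable borel Z" and "0 < \<mu>"
    and lim: "\<And>z. ((\<lambda>s. psi_ss \<mu> \<tau> (z - h s)) \<longlongrightarrow> l) at_top"
  shows "((\<lambda>s::real. expectation (\<lambda>\<omega>. psi_ss \<mu> \<tau> (Z \<omega> - h s))) \<longlongrightarrow> l) at_top"
proof -
  have "((\<lambda>s. expectation (\<lambda>\<omega>. psi_ss \<mu> \<tau> (Z \<omega> - h s))) \<longlongrightarrow> expectation (\<lambda>\<omega>. l)) at_top"
    by (rule integral_dominated_convergence_at_top[where w = "\<lambda>_. 1 + 2 / \<mu>"])
       (use assms in \<open>auto simp: psi_ss_nonneg psi_ss_le\<close>)
  then show ?thesis
    by (simp add: prob_space)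
qed

text \<open>The two ends of the level set in the definition of \<^const>\<open>SigVaR\<close>: it is nonempty because the
  expectation vanishes for large shifts, and bounded below because \<open>\<alpha>\<close> is smaller than the limit
  \<open>1 + 2 / \<mu>\<close> of the expectation for very negative shifts. Only then is the real-valued
  infimum informative.\<close>

lemma SigVaR_level_set_nonempty:
  assumes "random_variable borel Z" "0 < \<mu>" "0 < \<tau>" "0 < \<alpha>"
  shows "{t. expectation (\<lambda>\<omega>. psi_ss \<mu> \<tau> (Z \<omega> - t)) \<le> \<alpha>} \<noteq> {}"
proof -
  have "((\<lambda>t. psi_ss \<mu> \<tau> (z - t)) \<longlongrightarrow> 0) at_top" for z
    by (rule filterlim_compose[OF psi_ss_at_bot[OF assms(2,3)]]) real_asymp
  then have "((\<lambda>t. expectation (\<lambda>\<omega>. psi_ss \<mu> \<tau> (Z \<omega> - t))) \<longlongrightarrow> 0) at_top"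
    by (intro expectation_psi_ss_shift_tendsto assms)
  from order_tendstoD(2)[OF this \<open>0 < \<alpha>\<close>] obtain t
    where "expectation (\<lambda>\<omega>. psi_ss \<mu> \<tau> (Z \<omega> - t)) < \<alpha>"
    by (auto simp: eventually_at_top_linorder)
  then show ?thesis
    by (auto intro: less_imp_le)
qed

lemma SigVaR_level_set_upward_closed:
  assumes [measurable]: "random_variable borel Z" and "0 < \<mu>" "0 < \<tau>"
    and "expectation (\<lambda>\<omega>. psi_ss \<mu> \<tau> (Z \<omega> - s)) \<le> \<alpha>" "s \<le> t"
  shows "expectation (\<lambda>\<omega>. psi_ss \<mu> \<tau> (Z \<omega> - t)) \<le> \<alpha>"
proof -
  have "expectation (\<lambda>\<omega>. psi_ss \<mu> \<tau> (Z \<omega> - t)) \<le> expectation (\<lambda>\<omega>. psi_ss \<mu> \<tau> (Z \<omega> - s))"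
    using assms by (intro integral_mono integrable_psi_ss psi_ss_mono) auto
  then show ?thesis
    using assms by simp
qed

lemma SigVaR_level_set_bdd_below:
  assumes "random_variable borel Z" "0 < \<mu>" "0 < \<tau>" "\<alpha> < 1 + 2 / \<mu>"
  shows "bdd_below {t. expectation (\<lambda>\<omega>. psi_ss \<mu> \<tau> (Z \<omega> - t)) \<le> \<alpha>}"
proof -
  have "((\<lambda>s. psi_ss \<mu> \<tau> (z - (- s))) \<longlongrightarrow> 1 + 2 / \<mu>) at_top" for z
    by (rule filterlim_compose[OF psi_ss_at_top[OF assms(2,3)]]) real_asymp
  then have "((\<lambda>s. expectation (\<lambda>\<omega>. psi_ss \<mu> \<tau> (Z \<omega> - (- s)))) \<longlongrightarrow> 1 + 2 / \<mu>) at_top"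
    by (intro expectation_psi_ss_shift_tendsto assms)
  from order_tendstoD(1)[OF this \<open>\<alpha> < 1 + 2 / \<mu>\<close>] obtain s
    where s: "\<alpha> < expectation (\<lambda>\<omega>. psi_ss \<mu> \<tau> (Z \<omega> - (- s)))"
    by (auto simp: eventually_at_top_linorder)
  have "- s \<le> t" if "expectation (\<lambda>\<omega>. psi_ss \<mu> \<tau> (Z \<omega> - t)) \<le> \<alpha>" for t
    using SigVaR_level_set_upward_closed[OF assms(1-3) that, of "- s"] s by linarith
  then show ?thesis
    by (auto simp: bdd_below_def)
qed

lemma SigVaR_nonpos_of_expectation_le:
  assumes "random_variable borel Z" "0 < \<mu>" "0 < \<tau>" "\<alpha> < 1 + 2 / \<mu>"
    and "expectation (\<lambda>\<omega>. psi_ss \<mu> \<tau> (Z \<omega>)) \<le> \<alpha>"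
  shows "SigVaR M \<mu> \<tau> \<alpha> Z \<le> 0"
  unfolding SigVaR_def
  using assms by (intro cInf_lower SigVaR_level_set_bdd_below) auto

text \<open>A nonpositive infimum puts every \<open>t > 0\<close> into the level set, whence \<open>P(t \<le> Z) \<le> \<alpha>\<close>; the events
  \<open>{t \<le> Z}\<close> exhaust \<open>{0 < Z}\<close> as \<open>t\<close> decreases to \<open>0\<close>.\<close>

lemma prob_pos_le_of_SigVaR_nonpos:
  assumes [measurable]: "random_variable borel Z" and "0 < \<mu>" "0 < \<tau>" "0 < \<alpha>"
    and SigVaR: "SigVaR M \<mu> \<tau> \<alpha> Z \<le> 0"
  shows "\<P>(\<omega> in M. 0 < Z \<omega>) \<le> \<alpha>"
proof -
  have le: "\<P>(\<omega> in M. t \<le> Z \<omega>) \<le> \<alpha>" if "0 < t" for t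
  proof -
    have "Inf {t. expectation (\<lambda>\<omega>. psi_ss \<mu> \<tau> (Z \<omega> - t)) \<le> \<alpha>} < t"
      using SigVaR that by (simp add: SigVaR_def)
    from cInf_lessD[OF SigVaR_level_set_nonempty this] assms obtain s
      where "expectation (\<lambda>\<omega>. psi_ss \<mu> \<tau> (Z \<omega> - s)) \<le> \<alpha>" "s < t"
      by auto
    then have "expectation (\<lambda>\<omega>. psi_ss \<mu> \<tau> (Z \<omega> - t)) \<le> \<alpha>"
      using assms by (auto intro: SigVaR_level_set_upward_closed[where s = s and \<mu> = \<mu>])
    moreover have "\<P>(\<omega> in M. 0 \<le> Z \<omega> - t) \<le> expectation (\<lambda>\<omega>. psi_ss \<mu> \<tau> (Z \<omega> - t))"
      using assms by (intro prob_nonneg_le_expectation_psi_ss) auto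
    ultimately show ?thesis
      by simp
  qed
  define A where "A n = {\<omega> \<in> space M. inverse (real (Suc n)) \<le> Z \<omega>}" for n
  have "(\<lambda>n. prob (A n)) \<longlonglongrightarrow> prob (\<Union>n. A n)"
  proof (rule finite_Lim_measure_incseq)
    show "incseq A"
      unfolding A_def by (intro monoI) (force intro: order_trans[rotated] le_imp_inverse_le)
  qed (auto simp: A_def)
  moreover have "(\<Union>n. A n) = {\<omega> \<in> space M. 0 < Z \<omega>}"
  proof (intro equalityI subsetI)
    fix \<omega> assume "\<omega> \<in> (\<Union>n. A n)"
    then show "\<omega> \<in> {\<omega> \<in> space M. 0 < Z \<omega>}"
      by (auto simp: A_def) (metis inverse_positive_iff_positive of_nat_0_less_iff less_le_trans zero_less_Suc of_nat_Suc)
  next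
    fix \<omega> assume "\<omega> \<in> {\<omega> \<in> space M. 0 < Z \<omega>}"
    then show "\<omega> \<in> (\<Union>n. A n)"
      using reals_Archimedean[of "Z \<omega>"] by (auto simp: A_def intro: less_imp_le)
  qed
  ultimately show ?thesis
    using le by (intro LIMSEQ_le_const2[of "\<lambda>n. prob (A n)"]) (auto simp: A_def)
qed

lemma expectation_psi_ss_tendsto_prob:
  assumes [measurable]: "random_variable borel Z" and "0 < \<theta>"
  shows "((\<lambda>\<mu>. expectation (\<lambda>\<omega>. psi_ss \<mu> ((1 + \<mu>) * \<theta>) (Z \<omega>))) \<longlongrightarrow> \<P>(\<omega> in M. 0 \<le> Z \<omega>)) at_top"
proof -
  have "((\<lambda>\<mu>. expectation (\<lambda>\<omega>. psi_ss \<mu> ((1 + \<mu>) * \<theta>) (Z \<omega>))) \<longlongrightarrow>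
          expectation (\<lambda>\<omega>. indicator {0..} (Z \<omega>))) at_top"
  proof (rule integral_dominated_convergence_at_top[where w = "\<lambda>_. 3"])
    \<comment> \<open>The supremum \<open>1 + 2 / \<mu>\<close> is at most \<open>3\<close> once \<open>1 \<le> \<mu>\<close>.\<close>
    have le: "psi_ss \<mu> \<tau> z \<le> 3" if "1 \<le> \<mu>" for \<mu> \<tau> z
      using psi_ss_le[of \<mu> \<tau> z] that divide_left_mono[of 1 \<mu> 2] by simp
    show "\<forall>\<^sub>F \<mu> in at_top. AE \<omega> in M. norm (psi_ss \<mu> ((1 + \<mu>) * \<theta>) (Z \<omega>)) \<le> 3"
      using eventually_ge_at_top[of 1] by eventually_elim (simp add: le psi_ss_nonneg)
    show "AE \<omega> in M. ((\<lambda>\<mu>. psi_ss \<mu> ((1 + \<mu>) * \<theta>) (Z \<omega>)) \<longlongrightarrow> indicator {0..} (Z \<omega>)) at_top"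
      using psi_ss_tendsto_indicator[OF \<open>0 < \<theta>\<close>] by simp
  qed auto
  also have "expectation (\<lambda>\<omega>. indicator {0..} (Z \<omega>)) =
      expectation (indicator {\<omega> \<in> space M. 0 \<le> Z \<omega>})"
    by (intro Bochner_Integration.integral_cong) (auto simp: indicator_def)
  finally show ?thesis
    by simp
qed

lemma prob_nonneg_eq_prob_pos_of_isCont_cdf:
  assumes [measurable]: "random_variable borel Z" and cont: "isCont (cdf (distr M borel Z)) 0"
  shows "\<P>(\<omega> in M. 0 \<le> Z \<omega>) = \<P>(\<omega> in M. 0 < Z \<omega>)"
proof -
  interpret Z: real_distribution "distr M borel Z"
    by (rule real_distribution_distr) (rule assms)
  have "measure (distr M borel Z) {0} = 0"
    using cont by (simp add: Z.isCont_cdf)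
  then have "prob {\<omega> \<in> space M. Z \<omega> = 0} = 0"
    by (simp add: measure_distr vimage_def Int_def conj_commute)
  then have "AE \<omega> in M. Z \<omega> \<noteq> 0"
    by (subst (asm) prob_eq_0) auto
  then show ?thesis
    by (intro finite_measure_eq_AE) auto
qed

lemma sigvar_feasible_subset_chance_feasible:
  assumes rv: "\<And>x. random_variable borel (\<lambda>\<omega>. f x (\<Xi> \<omega>))"
    and "0 < \<mu>" "0 < \<tau>" "0 < \<alpha>"
  shows "sigvar_feasible M \<Xi> f X \<mu> \<tau> \<alpha> \<subseteq> chance_feasible M \<Xi> f X \<alpha>"
proof
  fix x assume x: "x \<in> sigvar_feasible M \<Xi> f X \<mu> \<tau> \<alpha>"
  note [measurable] = rv
  have "\<P>(\<omega> in M. f x (\<Xi> \<omega>) > 0) \<le> \<alpha>"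
    using x assms
    by (intro prob_pos_le_of_SigVaR_nonpos[where \<mu> = \<mu> and \<tau> = \<tau>]) (auto simp: sigvar_feasible_def)
  moreover have "\<P>(\<omega> in M. f x (\<Xi> \<omega>) > 0) = 1 - \<P>(\<omega> in M. f x (\<Xi> \<omega>) \<le> 0)"
    by (subst prob_neg[symmetric]) (auto simp: not_le)
  ultimately show "x \<in> chance_feasible M \<Xi> f X \<alpha>"
    using x by (auto simp: chance_feasible_def sigvar_feasible_def)
qed

lemma eventually_sigvar_feasible:
  assumes rv: "\<And>x. random_variable borel (\<lambda>\<omega>. f x (\<Xi> \<omega>))"
    and "0 < \<theta>" "\<alpha> \<le> 1"
    and "isCont (cdf (distr M borel (\<lambda>\<omega>. f x (\<Xi> \<omega>)))) 0"
    and x: "x \<in> chance_feasible_strict M \<Xi> f X \<alpha>"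
  shows "\<forall>\<^sub>F \<mu> in at_top. x \<in> sigvar_feasible M \<Xi> f X \<mu> ((1 + \<mu>) * \<theta>) \<alpha>"
proof -
  have "\<P>(\<omega> in M. 0 \<le> f x (\<Xi> \<omega>)) < \<alpha>"
    using x prob_nonneg_eq_prob_pos_of_isCont_cdf[OF rv, of x] assms
    by (simp add: chance_feasible_strict_def)
  from order_tendstoD(2)[OF expectation_psi_ss_tendsto_prob[OF rv \<open>0 < \<theta>\<close>] this]
  have "\<forall>\<^sub>F \<mu> in at_top. expectation (\<lambda>\<omega>. psi_ss \<mu> ((1 + \<mu>) * \<theta>) (f x (\<Xi> \<omega>))) < \<alpha>" .
  then show ?thesis
    using eventually_gt_at_top[of 0]
  proof eventually_elim
    case (elim \<mu>)
    have "\<alpha> < 1 + 2 / \<mu>"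
      using divide_pos_pos[of 2 \<mu>] elim \<open>\<alpha> \<le> 1\<close> by linarith
    then have "SigVaR M \<mu> ((1 + \<mu>) * \<theta>) \<alpha> (\<lambda>\<omega>. f x (\<Xi> \<omega>)) \<le> 0"
      using elim \<open>0 < \<theta>\<close> by (intro SigVaR_nonpos_of_expectation_le rv) auto
    then show ?case
      using x by (auto simp: sigvar_feasible_def chance_feasible_strict_def)
  qed
qed

end

section \<open>Optimization over feasible sets with a dense inner approximation\<close>

text \<open>The lower bound is inclusion in \<open>F\<close>. For the upper bound, a value above the optimum is beaten
  by some point of \<open>F\<close>, hence by continuity of the objective by some point of the dense set \<open>I\<close>,
  and that fixed point is eventually feasible. When \<open>F\<close> is empty, the lower bound alone forces the
  value \<open>\<infinity>\<close>.\<close>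

lemma optimal_value_tendsto_of_dense_inner:
  fixes \<phi> :: "'x::topological_space \<Rightarrow> real" and G :: "'i \<Rightarrow> 'x set"
  assumes cont: "continuous_on UNIV \<phi>"
    and outer: "\<forall>\<^sub>F i in \<F>. G i \<subseteq> F"
    and dense: "F = closure I"
    and inner: "\<And>x. x \<in> I \<Longrightarrow> \<forall>\<^sub>F i in \<F>. x \<in> G i"
  shows "((\<lambda>i. optimal_value \<phi> (G i)) \<longlongrightarrow> optimal_value \<phi> F) \<F>"
proof (rule order_tendstoI)
  fix a assume "a < optimal_value \<phi> F"
  then show "\<forall>\<^sub>F i in \<F>. a < optimal_value \<phi> (G i)"
    using outer
    by (auto elim!: eventually_mono less_le_trans intro: INF_superset_mono simp: optimal_value_def)
next
  fix a assume "optimal_value \<phi> F < a"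
  then obtain y where y: "y \<in> closure I" "ereal (\<phi> y) < a"
    by (auto simp: optimal_value_def INF_less_iff dense)
  have "open {x. ereal (\<phi> x) < a}"
    using cont by (intro open_Collect_less continuous_intros)
  with y have "I \<inter> {x. ereal (\<phi> x) < a} \<noteq> {}"
    by (auto simp: closure_iff_nhds_not_empty)
  then obtain x where x: "x \<in> I" "ereal (\<phi> x) < a"
    by auto
  show "\<forall>\<^sub>F i in \<F>. optimal_value \<phi> (G i) < a"
    using inner[OF x(1)] x(2)
    by (auto elim!: eventually_mono simp: optimal_value_def INF_less_iff)
qed

text \<open>A cluster point of optimal points stays in the closed set \<open>F\<close>, and in the limit it is at least as
  good as each point of \<open>I\<close>, because that point eventually competes; continuity of the
  objective extends the comparison to the closure of \<open>I\<close>.\<close>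

lemma outer_limit_optimal_solutions_of_dense_inner:
  fixes \<phi> :: "'x::t2_space \<Rightarrow> real" and G :: "real \<Rightarrow> 'x set"
  assumes cont: "continuous_on UNIV \<phi>"
    and outer: "\<And>\<mu>. 0 < \<mu> \<Longrightarrow> G \<mu> \<subseteq> F"
    and dense: "F = closure I"
    and inner: "\<And>x. x \<in> I \<Longrightarrow> \<forall>\<^sub>F \<mu> in at_top. x \<in> G \<mu>"
  shows "outer_limit_at_top (\<lambda>\<mu>. optimal_solutions \<phi> (G \<mu>)) \<subseteq> optimal_solutions \<phi> F"
proof
  fix z assume "z \<in> outer_limit_at_top (\<lambda>\<mu>. optimal_solutions \<phi> (G \<mu>))"
  then obtain \<mu> :: "nat \<Rightarrow> real" and x and r :: "nat \<Rightarrow> nat"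
    where \<mu>: "filterlim \<mu> at_top sequentially" "\<And>k. 0 < \<mu> k"
      and x: "\<And>k. x k \<in> optimal_solutions \<phi> (G (\<mu> k))"
      and r: "strict_mono r" and z: "(x \<circ> r) \<longlonglongrightarrow> z"
    by (auto simp: outer_limit_at_top_def)
  have "x k \<in> F" for k
    using x[of k] outer[OF \<mu>(2)] by (auto simp: optimal_solutions_def)
  then have "z \<in> F"
    using z by (intro Lim_in_closed_set[of F "x \<circ> r" sequentially]) (auto simp: dense)
  have \<mu>r: "filterlim (\<lambda>k. \<mu> (r k)) at_top sequentially"
    using filterlim_compose[OF \<mu>(1) filterlim_subseq[OF r]] .
  have lim: "(\<lambda>k. \<phi> (x (r k))) \<longlonglongrightarrow> \<phi> z"
    using continuous_on_tendsto_compose[OF cont z] by simp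
  have "\<phi> z \<le> \<phi> y" if "y \<in> I" for y
  proof (rule tendsto_upperbound[OF lim])
    have "\<forall>\<^sub>F k in sequentially. y \<in> G (\<mu> (r k))"
      using filterlim_iff[THEN iffD1, OF \<mu>r] inner[OF that] by blast
    then show "\<forall>\<^sub>F k in sequentially. \<phi> (x (r k)) \<le> \<phi> y"
      using x by (auto elim!: eventually_mono simp: optimal_solutions_def)
  qed simp
  moreover have "closed {y. \<phi> z \<le> \<phi> y}"
    using cont by (intro closed_Collect_le continuous_intros)
  ultimately have "closure I \<subseteq> {y. \<phi> z \<le> \<phi> y}"
    by (intro closure_minimal) auto
  with \<open>z \<in> F\<close> show "z \<in> optimal_solutions \<phi> F"
    by (auto simp: optimal_solutions_def dense)
qed

section \<open>Convergence of the SigVaR problems\<close>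

lemma twice_cont_differentiable_imp_continuous_on:
  "twice_cont_differentiable f \<Longrightarrow> continuous_on UNIV f"
  unfolding twice_cont_differentiable_def
  by (meson continuous_at_imp_continuous_on has_derivative_continuous)

theorem theorem3:
  fixes M :: "'w measure"
    and \<Xi> :: "'w \<Rightarrow> real ^ 'd"
    and g :: "real ^ 'n \<Rightarrow> real ^ 'm"
    and \<phi> :: "real ^ 'n \<Rightarrow> real"
    and f :: "real ^ 'n \<Rightarrow> real ^ 'd \<Rightarrow> real"
    and X :: "(real ^ 'n) set"
    and \<alpha> \<theta> :: real
    and \<tau> :: "real \<Rightarrow> real"
  defines "X \<equiv> constraint_set g"
    and "\<tau> \<equiv> \<lambda>\<mu>. (1 + \<mu>) * \<theta>"
  assumes "prob_space M"
    and "\<Xi> \<in> borel_measurable M"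
    and "twice_differentiable g"
    and "twice_cont_differentiable \<phi>"
    and "twice_cont_differentiable (\<lambda>(x, \<xi>). f x \<xi>)"
    and "X \<noteq> {}"
    and "compact X"
    and "\<And>\<beta>. 0 < \<beta> \<Longrightarrow> \<beta> \<le> 1 \<Longrightarrow> compact (chance_feasible M \<Xi> f X \<beta>)"
    and "\<exists>\<kappa>>0. \<forall>x\<in>X. \<exists>L. L-lipschitz_on {-\<kappa>..\<kappa>} (cdf (distr M borel (\<lambda>\<omega>. f x (\<Xi> \<omega>))))"
    and "chance_feasible M \<Xi> f X \<alpha> = closure (chance_feasible_strict M \<Xi> f X \<alpha>)"
    and "0 < \<alpha>" and "\<alpha> \<le> 1"
    and "0 < \<theta>"
  shows "((\<lambda>\<mu>. optimal_value \<phi> (sigvar_feasible M \<Xi> f X \<mu> (\<tau> \<mu>) \<alpha>))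
            \<longlongrightarrow> optimal_value \<phi> (chance_feasible M \<Xi> f X \<alpha>)) at_top \<and>
         outer_limit_at_top (\<lambda>\<mu>. optimal_solutions \<phi> (sigvar_feasible M \<Xi> f X \<mu> (\<tau> \<mu>) \<alpha>))
            \<subseteq> optimal_solutions \<phi> (chance_feasible M \<Xi> f X \<alpha>)"
proof -
  interpret prob_space M
    by fact
  have [measurable]: "\<Xi> \<in> borel_measurable M"
    by fact
  have cont: "continuous_on UNIV \<phi>" and "continuous_on UNIV (\<lambda>(x, \<xi>). f x \<xi>)"
    using assms by (auto intro: twice_cont_differentiable_imp_continuous_on)
  then have "continuous_on UNIV (f x)" for x
    using continuous_on_compose2[of UNIV "\<lambda>(x, \<xi>). f x \<xi>" UNIV "\<lambda>\<xi>. (x, \<xi>)"]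
    by (simp add: continuous_on_Pair)
  then have rv: "random_variable borel (\<lambda>\<omega>. f x (\<Xi> \<omega>))" for x
    by (intro measurable_compose[OF \<open>\<Xi> \<in> borel_measurable M\<close>] borel_measurable_continuous_onI)
  have cdf: "isCont (cdf (distr M borel (\<lambda>\<omega>. f x (\<Xi> \<omega>)))) 0" if x: "x \<in> X" for x
  proof -
    obtain \<kappa> L where "0 < \<kappa>"
      and "L-lipschitz_on {-\<kappa>..\<kappa>} (cdf (distr M borel (\<lambda>\<omega>. f x (\<Xi> \<omega>))))"
      using assms x by blast
    then show ?thesis
      using lipschitz_on_continuous_on
      by (intro continuous_on_interior[of "{-\<kappa>..\<kappa>}"]) auto
  qed
  let ?G = "\<lambda>\<mu>. sigvar_feasible M \<Xi> f X \<mu> (\<tau> \<mu>) \<alpha>"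
  let ?F = "chance_feasible M \<Xi> f X \<alpha>" and ?I = "chance_feasible_strict M \<Xi> f X \<alpha>"
  have outer: "?G \<mu> \<subseteq> ?F" if "0 < \<mu>" for \<mu>
    using that \<open>0 < \<theta>\<close> \<open>0 < \<alpha>\<close> unfolding \<tau>_def
    by (intro sigvar_feasible_subset_chance_feasible rv) auto
  have inner: "\<forall>\<^sub>F \<mu> in at_top. x \<in> ?G \<mu>" if "x \<in> ?I" for x
    using that \<open>0 < \<theta>\<close> \<open>\<alpha> \<le> 1\<close> unfolding \<tau>_def
    by (intro eventually_sigvar_feasible rv cdf) (auto simp: chance_feasible_strict_def)
  have dense: "?F = closure ?I"
    by fact
  have "\<forall>\<^sub>F \<mu> in at_top. ?G \<mu> \<subseteq> ?F"
    using eventually_gt_at_top[of 0] by eventually_elim (rule outer)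
  then show ?thesis
    using optimal_value_tendsto_of_dense_inner[OF cont _ dense inner]
      outer_limit_optimal_solutions_of_dense_inner[OF cont outer dense inner]
    by blast
qed

end
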